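(* Let $m\ge1$ and let $u$ be a permutation of $[m]=\{1,\dots,m\}$, written in one-line notation as a word. Then $u$ is $m$-stable, i.e. $C(u^k)=C(u^m)$ for all integers $k\ge m$.
   Context: Words are finite sequences of positive integers; juxtaposition denotes concatenation, and $u^k$ denotes $u$ concatenated with itself $k$ times. For a word $w$, $P(w)$ is its insertion tableau under the Robinson–Schensted–Knuth (row-insertion) correspondence. The centralizer of a word $u$ is $C(u)=\{w \text{ a word over the positive integers} : P(uw)=P(wu)\}$. A word $u$ is $K$-stable if $C(u^k)=C(u^K)$ for all $k\ge K$. *)

theory Defs
  imports "HOL-Combinatorics.Multiset_Permutations"
begin

definition words :: "nat list set" where
  "words = lists {0<..}"

definition word_power :: "nat list \<Rightarrow> nat \<Rightarrow> nat list" where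
  "word_power u k = concat (replicate k u)"

text \<open>
  Inserting \<open>x\<close> into a weakly increasing row replaces the leftmost entry strictly greater
  than \<open>x\<close> and returns it as the bumped entry; if there is no such entry, \<open>x\<close> is appended
  and nothing is bumped.
\<close>

fun row_insert :: "nat \<Rightarrow> nat list \<Rightarrow> nat option \<times> nat list" where
  "row_insert x [] = (None, [x])"
| "row_insert x (y # ys) =
     (if x < y then (Some y, x # ys)
      else (case row_insert x ys of (b, zs) \<Rightarrow> (b, y # zs)))"

text \<open>A tableau is the list of its rows, the first (longest) row coming first.\<close>

fun tableau_insert :: "nat \<Rightarrow> nat list list \<Rightarrow> nat list list" where
  "tableau_insert x [] = [[x]]"
| "tableau_insert x (r # rs) =
     (case row_insert x r of
        (None, r') \<Rightarrow> r' # rs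
      | (Some y, r') \<Rightarrow> r' # tableau_insert y rs)"

text \<open>Letters are inserted from left to right, starting with the empty tableau.\<close>

definition insertion_tableau :: "nat list \<Rightarrow> nat list list" where
  "insertion_tableau w = fold tableau_insert w []"

definition centralizer :: "nat list \<Rightarrow> nat list set" where
  "centralizer u = {w \<in> words. insertion_tableau (u @ w) = insertion_tableau (w @ u)}"

definition K_stable :: "nat \<Rightarrow> nat list \<Rightarrow> bool" where
  "K_stable K u \<longleftrightarrow>
     (\<forall>k\<ge>K. centralizer (word_power u k) = centralizer (word_power u K))"

end

theory Submission
  imports Defs
begin

text \<open>
  Greene's theorem turns the statement into combinatorics of chains. Let \<open>greene r w\<close> be the
  largest number of letters of \<open>w\<close> that can be covered by \<open>r\<close> disjoint weakly increasing
  subsequences. It is invariant under Knuth moves, and its value at the reading word of a tableau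
  is the total length of the first \<open>r\<close> rows. Hence two words have the same tableau iff \<open>greene\<close>
  agrees on their restrictions to the letters \<open>\<le> i\<close>, for all \<open>i\<close>.

  For a permutation \<open>u\<close> of \<open>[m]\<close> and \<open>k \<ge> m - 1\<close>, a decomposition of \<open>u\<^sup>k\<close> into decreasing
  subsequences and a matching family of chains determine \<open>greene r (u\<^sup>k)\<close>, which gives
  \<open>u\<^sup>k\<^sup>+\<^sup>1 \<approx> c u\<^sup>k\<close> for the column \<open>c = m \<dots> 2 1\<close>. This column is central and cancellable among the
  words over \<open>[m]\<close>, which settles the case of a word \<open>w\<close> over \<open>[m]\<close>. In general, if \<open>w\<close> commutes
  with \<open>u\<^sup>k\<close>, \<open>k \<ge> m\<close>, then inserting \<open>c\<close> into the tableau of \<open>w\<close> may not push a letter above \<open>m\<close>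
  out of the first \<open>m\<close> rows, so there is none in these rows; and for such \<open>w\<close> only the letters
  \<open>\<le> m\<close> matter.
\<close>

section \<open>Greene invariants and Knuth equivalence\<close>

text \<open>In a coloured word, a list of pairs of a letter and a colour, the letters of each colour below
  \<open>r\<close> form a chain, and the letters of the other colours are not covered.\<close>

definition chains :: "nat \<Rightarrow> (nat \<times> nat) list \<Rightarrow> bool" where
  "chains r cs \<longleftrightarrow> sorted_wrt (\<lambda>p q. snd p = snd q \<longrightarrow> snd p < r \<longrightarrow> fst p \<le> fst q) cs"

definition used :: "nat \<Rightarrow> (nat \<times> nat) list \<Rightarrow> nat" where
  "used r cs = length (filter (\<lambda>p. snd p < r) cs)"

definition greene :: "nat \<Rightarrow> nat list \<Rightarrow> nat" where
  "greene r w = Max {used r cs | cs. map fst cs = w \<and> chains r cs}"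

lemma used_append [simp]: "used r (xs @ ys) = used r xs + used r ys"
  by (simp add: used_def)

lemma used_Nil [simp]: "used r [] = 0"
  by (simp add: used_def)

lemma used_Cons [simp]: "used r (p # ps) = (if snd p < r then Suc (used r ps) else used r ps)"
  by (simp add: used_def)

lemma used_le_length: "used r cs \<le> length cs"
  by (simp add: used_def)

lemma chains_append:
  "chains r (xs @ ys) \<longleftrightarrow> chains r xs \<and> chains r ys \<and>
     (\<forall>l l' e. (l, e) \<in> set xs \<longrightarrow> (l', e) \<in> set ys \<longrightarrow> e < r \<longrightarrow> l \<le> l')"
  by (fastforce simp: chains_def sorted_wrt_append)

lemma chains_Cons:
  "chains r (p # cs) \<longleftrightarrow> chains r cs \<and> (\<forall>l. (l, snd p) \<in> set cs \<longrightarrow> snd p < r \<longrightarrow> fst p \<le> l)"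
  by (cases p) (fastforce simp: chains_def)

lemma chains_Nil [simp]: "chains r []"
  by (simp add: chains_def)

lemma chains_recolour:
  assumes "\<And>c d. f c = f d \<longleftrightarrow> c = d" "\<And>c. f c < r \<longleftrightarrow> c < r"
  shows "chains r (map (\<lambda>(l, c). (l, f c)) cs) = chains r cs"
    and "used r (map (\<lambda>(l, c). (l, f c)) cs) = used r cs"
  using assms by (induction cs) (fastforce simp: chains_Cons)+

lemma finite_used: "finite {used r cs | cs. map fst cs = w \<and> chains r cs}"
proof (rule finite_subset)
  show "{used r cs | cs. map fst cs = w \<and> chains r cs} \<subseteq> {..length w}"
    using used_le_length by force
qed simp

lemma used_le_greene: "chains r cs \<Longrightarrow> used r cs \<le> greene r (map fst cs)"
  unfolding greene_def by (rule Max_ge[OF finite_used]) auto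

lemma greene_attained:
  obtains cs where "map fst cs = w" "chains r cs" "used r cs = greene r w"
proof -
  \<comment> \<open>Colour \<open>r\<close> is not below \<open>r\<close>, so nothing is covered;
    this makes the set under \<open>Max\<close> nonempty.\<close>
  let ?cs = "map (\<lambda>x. (x, r)) w"
  have "map fst ?cs = w \<and> chains r ?cs"
    by (auto simp: chains_def sorted_wrt_map comp_def intro: sorted_wrt_mono_rel[OF _ sorted_wrt_true])
  then have "{used r cs | cs. map fst cs = w \<and> chains r cs} \<noteq> {}"
    by blast
  from Max_in[OF finite_used this] that show thesis
    unfolding greene_def by auto
qed

lemma greene_leI:
  assumes "\<And>cs. map fst cs = w \<Longrightarrow> chains r cs \<Longrightarrow> used r cs \<le> n"
  shows "greene r w \<le> n"
  using assms greene_attained by metis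

lemma greene_le_length: "greene r w \<le> length w"
  by (rule greene_leI) (use used_le_length in auto)

lemma greene_append_le: "greene r (x @ y) \<le> greene r x + greene r y"
proof (rule greene_leI)
  fix cs assume cs: "map fst cs = x @ y" "chains r cs"
  then obtain a b where "cs = a @ b" "map fst a = x" "map fst b = y"
    by (auto simp: map_eq_append_conv)
  then show "used r cs \<le> greene r x + greene r y"
    using cs(2) used_le_greene[of r a] used_le_greene[of r b] by (simp add: chains_append)
qed

text \<open>All copies of one letter form a chain. Letter \<open>l\<close> gets colour
  \<open>l - 1\<close>; a letter 0 would share its colour with 1.\<close>

lemma filter_le_greene:
  assumes "0 \<notin> set w"
  shows "length (filter (\<lambda>l. l \<le> r) w) \<le> greene r w"
proof -
  let ?cs = "map (\<lambda>l. (l, l - 1)) w"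
  have "chains r ?cs"
    using assms by (auto simp: chains_def sorted_wrt_map sorted_wrt_iff_nth_less)
      (metis (no_types, lifting) One_nat_def Suc_pred' bot_nat_0.not_eq_extremum le_eq_less_or_eq less_trans nth_mem)
  moreover have "used r ?cs = length (filter (\<lambda>l. l \<le> r) w)"
    using assms by (induction w) auto
  moreover have "map fst ?cs = w" by (simp add: comp_def)
  ultimately show ?thesis by (metis used_le_greene)
qed

section \<open>Knuth equivalence and its invariants\<close>

inductive plactic :: "nat list \<Rightarrow> nat list \<Rightarrow> bool" (infix "\<approx>" 50) where
  knuth1: "x < y \<Longrightarrow> y \<le> z \<Longrightarrow> [y, x, z] \<approx> [y, z, x]"
| knuth2: "x \<le> y \<Longrightarrow> y < z \<Longrightarrow> [x, z, y] \<approx> [z, x, y]"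
| plactic_refl [simp, intro]: "w \<approx> w"
| plactic_sym: "w \<approx> w' \<Longrightarrow> w' \<approx> w"
| plactic_trans [trans]: "w \<approx> w' \<Longrightarrow> w' \<approx> w'' \<Longrightarrow> w \<approx> w''"
| plactic_cong: "w \<approx> w' \<Longrightarrow> a @ w @ b \<approx> a @ w' @ b"

lemma plactic_append: "w \<approx> w' \<Longrightarrow> v \<approx> v' \<Longrightarrow> w @ v \<approx> w' @ v'"
  using plactic_cong[of w w' "[]" v] plactic_cong[of v v' w' "[]"] by (auto intro: plactic_trans)

text \<open>The condition makes \<open>f\<close> select an interval of letters. If both exchanged
  letters \<open>x\<close> and \<open>z\<close> survive, so does the intermediate \<open>y\<close>;
  otherwise both sides become equal.\<close>

lemma plactic_filter:
  assumes "w \<approx> w'" and "\<And>x y z. f x \<Longrightarrow> f z \<Longrightarrow> x \<le> y \<Longrightarrow> y \<le> z \<Longrightarrow> f y"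
  shows "filter f w \<approx> filter f w'"
  using assms(1)
proof induction
  case (knuth1 x y z)
  then show ?case using assms(2)[of x z y] by (auto intro: plactic.intros)
next
  case (knuth2 x y z)
  then show ?case using assms(2)[of x z y] by (auto intro: plactic.intros)
qed (auto intro: plactic.intros)

lemma plactic_mset: "w \<approx> w' \<Longrightarrow> mset w = mset w'"
  by (induction rule: plactic.induct) auto

text \<open>Chain \<open>c\<close> enters the middle at most at \<open>x\<close> and chain
  \<open>d\<close> at most at \<open>y\<close>, while their tails start at least at \<open>z\<close>
  and \<open>y\<close>. In \<open>mid'\<close> colour \<open>c\<close> stays between
  \<open>x\<close> and \<open>y\<close>, colour \<open>d\<close> between \<open>y\<close> and
  \<open>z\<close>, so each can go on with the old tail of the other.\<close>

lemma chains_exchange_tails: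
  assumes ch: "chains r (a @ mid @ b)" "chains r mid'"
    and mid: "(x, c) \<in> set mid" "(y, d) \<in> set mid" "(z, c) \<in> set mid" "x \<le> y" "y \<le> z"
    and mid': "\<And>l e. (l, e) \<in> set mid' \<Longrightarrow> e = c \<and> x \<le> l \<and> l \<le> y \<or> e = d \<and> y \<le> l \<and> l \<le> z"
    and cd: "c < r" "d < r" "c \<noteq> d"
  obtains b' where "map fst b' = map fst b" "used r b' = used r b" "chains r (a @ mid' @ b')"
proof -
  define f where "f e = (if e = c then d else if e = d then c else e)" for e
  define b' where "b' = map (\<lambda>(l, e). (l, f e)) b"
  have f: "f e < r \<longleftrightarrow> e < r" "f e = f e' \<longleftrightarrow> e = e'" for e e'
    using cd by (auto simp: f_def)
  have b': "map fst b' = map fst b" "used r b' = used r b" "chains r b' \<longleftrightarrow> chains r b"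
    using f by (simp_all add: b'_def chains_recolour comp_def case_prod_beta)
  have parts: "chains r a" "chains r mid" "chains r b"
    using ch by (auto simp: chains_append)
  have cross: "l \<le> l'" if "(l, e) \<in> set a" "(l', e) \<in> set mid \<union> set b" "e < r" for l l' e
    using that ch(1) unfolding chains_append by fastforce
  have cross': "l \<le> l'" if "(l, e) \<in> set mid" "(l', e) \<in> set b" "e < r" for l l' e
    using that ch(1) unfolding chains_append by fastforce
  have 1: "l \<le> l'" if "(l, e) \<in> set a" "(l', e) \<in> set mid'" for l l' e
    using mid'[OF that(2)] cross[of l c x] cross[of l d y] that mid cd by force
  have 2: "l \<le> l'" if "(l, f e) \<in> set mid'" "(l', e) \<in> set b" for l l' e
  proof -
    have "f e = c \<longleftrightarrow> e = d" "f e = d \<longleftrightarrow> e = c"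
      using cd by (auto simp: f_def)
    then show ?thesis
      using mid'[OF that(1)] cross'[of z c l'] cross'[of y d l'] that mid cd by force
  qed
  \<comment> \<open>Heads and tails of swapped colours are compared through the middle letters of
    the original word.\<close>
  have 3: "l \<le> l'" if "(l, f e) \<in> set a" "(l', e) \<in> set b" "e < r" for l l' e
  proof -
    consider "e = c" "f e = d" | "e = d" "f e = c" | "f e = e"
      unfolding f_def by metis
    then show ?thesis
    proof cases
      case 1
      then show ?thesis using cross[of l d y] cross'[of z c l'] that mid cd by force
    next
      case 2
      then show ?thesis using cross[of l c x] cross'[of y d l'] that mid cd by force
    next
      case 3
      then show ?thesis using cross[of l e l'] that by simp
    qed
  qed
  have "chains r (a @ mid' @ b')"
    unfolding chains_append using parts ch(2) b'(3) 1 2 3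
    by (fastforce simp: b'_def f)
  with b' show thesis by (intro that)
qed

text \<open>If a Knuth move separates two consecutive letters of one chain, the third letter takes over
  the place of one of them, and the two chains involved exchange their tails.\<close>

lemma greene_knuth1:
  assumes "x < y" "y \<le> z"
  shows "greene r (a @ [y, x, z] @ b) = greene r (a @ [y, z, x] @ b)"
proof (rule antisym)
  show "greene r (a @ [y, z, x] @ b) \<le> greene r (a @ [y, x, z] @ b)"
  proof (rule greene_leI)
    fix cs assume "map fst cs = a @ [y, z, x] @ b" and ch: "chains r cs"
    then obtain a' b' cy cz cx where cs: "cs = a' @ [(y, cy), (z, cz), (x, cx)] @ b'"
        and [simp]: "map fst a' = a" "map fst b' = b"
      by (auto simp: map_eq_append_conv map_eq_Cons_conv)
    \<comment> \<open>The descent \<open>z, x\<close> never lies in one chain, so turning it into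
      the ascent \<open>x, z\<close> keeps the colouring valid.\<close>
    let ?cs = "a' @ [(y, cy), (x, cx), (z, cz)] @ b'"
    have "chains r ?cs" using ch assms unfolding cs
      by (auto simp: chains_append chains_Cons)
    from used_le_greene[OF this] show "used r cs \<le> greene r (a @ [y, x, z] @ b)"
      unfolding cs by (simp split: if_splits)
  qed
next
  show "greene r (a @ [y, x, z] @ b) \<le> greene r (a @ [y, z, x] @ b)"
  proof (rule greene_leI)
    fix cs assume "map fst cs = a @ [y, x, z] @ b" and ch: "chains r cs"
    then obtain a' b' cy cz cx where cs: "cs = a' @ [(y, cy), (x, cx), (z, cz)] @ b'"
        and [simp]: "map fst a' = a" "map fst b' = b"
      by (auto simp: map_eq_append_conv map_eq_Cons_conv)
    \<comment> \<open>The exchange hurts only if \<open>x\<close> and \<open>z\<close> share a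
      chain. An uncovered \<open>y\<close> then replaces \<open>x\<close> there; otherwise
      \<open>z\<close> joins the chain of \<open>y\<close> and tails are swapped.\<close>
    consider "cx \<noteq> cz \<or> cx \<ge> r" | "cx = cz" "cx < r" "cy \<ge> r" | "cx = cz" "cx < r" "cy < r"
      by linarith
    then have "\<exists>cs'. map fst cs' = a @ [y, z, x] @ b \<and> chains r cs' \<and> used r cs' = used r cs"
    proof cases
      case 1
      then show ?thesis using ch assms unfolding cs
        by (intro exI[of _ "a' @ [(y, cy), (z, cz), (x, cx)] @ b'"])
          (auto simp: chains_append chains_Cons)
    next
      case 2
      then show ?thesis using ch assms unfolding cs
        by (intro exI[of _ "a' @ [(y, cx), (z, cx), (x, cy)] @ b'"])
          (fastforce simp: chains_append chains_Cons)
    next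
      case 3
      then have ne: "cy \<noteq> cx" using ch assms unfolding cs
        by (auto simp: chains_append chains_Cons)
      have mid: "chains r [(y, cy), (z, cy), (x, cx)]"
        using ch assms ne unfolding cs by (auto simp: chains_append chains_Cons)
      from 3 ne assms obtain b'' where "map fst b'' = map fst b'" "used r b'' = used r b'"
          "chains r (a' @ [(y, cy), (z, cy), (x, cx)] @ b'')"
        by (elim chains_exchange_tails[OF ch[unfolded cs] mid, of x cx y cy z, rotated -1]) auto
      then show ?thesis using 3 unfolding cs
        by (intro exI[of _ "a' @ [(y, cy), (z, cy), (x, cx)] @ b''"]) auto
    qed
    then show "used r cs \<le> greene r (a @ [y, z, x] @ b)"
      by (metis used_le_greene)
  qed
qed

text \<open>The dual case: an uncovered \<open>y\<close> now replaces \<open>z\<close>, and a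
  covered one joins the chain of \<open>x\<close>, leaving its own place to
  \<open>z\<close>.\<close>

lemma greene_knuth2:
  assumes "x \<le> y" "y < z"
  shows "greene r (a @ [x, z, y] @ b) = greene r (a @ [z, x, y] @ b)"
proof (rule antisym)
  show "greene r (a @ [z, x, y] @ b) \<le> greene r (a @ [x, z, y] @ b)"
  proof (rule greene_leI)
    fix cs assume "map fst cs = a @ [z, x, y] @ b" and ch: "chains r cs"
    then obtain a' b' cy cz cx where cs: "cs = a' @ [(z, cz), (x, cx), (y, cy)] @ b'"
        and [simp]: "map fst a' = a" "map fst b' = b"
      by (auto simp: map_eq_append_conv map_eq_Cons_conv)
    let ?cs = "a' @ [(x, cx), (z, cz), (y, cy)] @ b'"
    have "chains r ?cs" using ch assms unfolding cs
      by (auto simp: chains_append chains_Cons)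
    from used_le_greene[OF this] show "used r cs \<le> greene r (a @ [x, z, y] @ b)"
      unfolding cs by (simp split: if_splits)
  qed
next
  show "greene r (a @ [x, z, y] @ b) \<le> greene r (a @ [z, x, y] @ b)"
  proof (rule greene_leI)
    fix cs assume "map fst cs = a @ [x, z, y] @ b" and ch: "chains r cs"
    then obtain a' b' cy cz cx where cs: "cs = a' @ [(x, cx), (z, cz), (y, cy)] @ b'"
        and [simp]: "map fst a' = a" "map fst b' = b"
      by (auto simp: map_eq_append_conv map_eq_Cons_conv)
    consider "cx \<noteq> cz \<or> cx \<ge> r" | "cx = cz" "cx < r" "cy \<ge> r" | "cx = cz" "cx < r" "cy < r"
      by linarith
    then have "\<exists>cs'. map fst cs' = a @ [z, x, y] @ b \<and> chains r cs' \<and> used r cs' = used r cs"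
    proof cases
      case 1
      then show ?thesis using ch assms unfolding cs
        by (intro exI[of _ "a' @ [(z, cz), (x, cx), (y, cy)] @ b'"])
          (auto simp: chains_append chains_Cons)
    next
      case 2
      then show ?thesis using ch assms unfolding cs
        by (intro exI[of _ "a' @ [(z, cy), (x, cx), (y, cx)] @ b'"])
          (fastforce simp: chains_append chains_Cons)
    next
      case 3
      then have ne: "cy \<noteq> cx" using ch assms unfolding cs
        by (auto simp: chains_append chains_Cons)
      have mid: "chains r [(z, cy), (x, cx), (y, cx)]"
        using ch assms ne unfolding cs by (auto simp: chains_append chains_Cons)
      from 3 ne assms obtain b'' where "map fst b'' = map fst b'" "used r b'' = used r b'"
          "chains r (a' @ [(z, cy), (x, cx), (y, cx)] @ b'')"
        by (elim chains_exchange_tails[OF ch[unfolded cs] mid, of x cx y cy z, rotated -1]) auto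
      then show ?thesis using 3 unfolding cs
        by (intro exI[of _ "a' @ [(z, cy), (x, cx), (y, cx)] @ b''"]) auto
    qed
    then show "used r cs \<le> greene r (a @ [z, x, y] @ b)"
      by (metis used_le_greene)
  qed
qed

lemma greene_plactic:
  assumes "w \<approx> w'"
  shows "greene r w = greene r w'"
proof -
  have "\<forall>a b. greene r (a @ w @ b) = greene r (a @ w' @ b)"
    using assms
  proof induction
    case (plactic_cong w w' a b)
    then show ?case by (metis append.assoc)
  qed (use greene_knuth1 greene_knuth2 in auto)
  from this[rule_format, of "[]" "[]"] show ?thesis by simp
qed

section \<open>Tableaux and reading words\<close>

definition reading :: "nat list list \<Rightarrow> nat list" where
  "reading T = concat (rev T)"

lemma reading_Nil [simp]: "reading [] = []"
  by (simp add: reading_def)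

lemma reading_Cons [simp]: "reading (row # T) = reading T @ row"
  by (simp add: reading_def)

fun dominates :: "nat list \<Rightarrow> nat list \<Rightarrow> bool" where
  "dominates _ [] = True"
| "dominates [] (b # s) = False"
| "dominates (a # t) (b # s) = (a < b \<and> dominates t s)"

text \<open>Empty rows are allowed here, so that discarding all letters above a bound is harmless.\<close>

fun tableau :: "nat list list \<Rightarrow> bool" where
  "tableau [] = True"
| "tableau [t] = sorted t"
| "tableau (t # s # T) = (sorted t \<and> dominates t s \<and> tableau (s # T))"

lemma tableau_Cons:
  "tableau (t # T) \<longleftrightarrow> sorted t \<and> (T \<noteq> [] \<longrightarrow> dominates t (hd T)) \<and> tableau T"
  by (cases T) auto

section \<open>Row insertion preserves tableaux\<close>

lemma row_insert_None: "row_insert x t = (None, t') \<Longrightarrow> t' = t @ [x]"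
  by (induction t arbitrary: t') (auto split: prod.splits if_splits)

lemma row_insert_bumped: "row_insert x t = (Some y, t') \<Longrightarrow> x < y"
  by (induction t arbitrary: t') (auto split: prod.splits if_splits)

lemma set_row_insert: "row_insert x t = (b, t') \<Longrightarrow> set t' \<subseteq> insert x (set t)"
  by (induction t arbitrary: t') (fastforce split: prod.splits if_splits)+

lemma row_insert_neq_Nil: "row_insert x t = (b, t') \<Longrightarrow> t' \<noteq> []"
  by (cases t) (auto split: prod.splits if_splits)

lemma sorted_row_insert: "row_insert x t = (b, t') \<Longrightarrow> sorted t \<Longrightarrow> sorted t'"
proof (induction t arbitrary: t')
  case (Cons y t)
  then show ?case
    using set_row_insert[of x t b] by (fastforce split: prod.splits if_splits)
qed simp

lemma dominates_row_insert:
  "row_insert x t = (b, t') \<Longrightarrow> dominates t s \<Longrightarrow> dominates t' s"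
proof (induction t s arbitrary: t' rule: dominates.induct)
  case (3 a t c s)
  then show ?case by (auto split: prod.splits if_splits)
qed auto

text \<open>In the column that \<open>y\<close> leaves, \<open>s\<close> has a larger entry or none,
  so \<open>y\<close> lands in that column or further left, where all entries of \<open>t'\<close>
  are smaller than \<open>y\<close>.\<close>

lemma dominates_bump:
  assumes "row_insert x t = (Some y, t')" "row_insert y s = (b, s')" "dominates t s" "sorted t"
  shows "dominates t' s'"
  using assms
proof (induction t s arbitrary: t' s' rule: dominates.induct)
  case (1 t)
  then show ?case using row_insert_bumped[OF 1(1)]
    by (cases t) (fastforce split: prod.splits if_splits dest: row_insert_bumped)+
next
  case (3 a t c s)
  show ?case
  proof (cases "x < a")
    case True
    with 3 show ?thesis by (auto split: if_splits)
  next
    case False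
    then obtain t1 where t1: "row_insert x t = (Some y, t1)" "t' = a # t1"
      using "3.prems"(1) by (auto split: prod.splits)
    have "a < y" using False row_insert_bumped[OF t1(1)] by simp
    then show ?thesis
      using 3 t1 False dominates_row_insert[OF t1(1)] by (auto split: prod.splits if_splits)
  qed
qed simp

lemma tableau_tableau_insert:
  assumes "tableau T"
  shows "tableau (tableau_insert x T)"
proof -
  \<comment> \<open>The second conjunct strengthens the induction: it is what a row from which
    \<open>x\<close> was bumped needs in order to stay above the new first row.\<close>
  have "tableau (tableau_insert x T) \<and>
    (\<forall>t b t'. T \<noteq> [] \<longrightarrow> dominates t (hd T) \<longrightarrow> sorted t \<longrightarrow> row_insert b t = (Some x, t') \<longrightarrow>
       dominates t' (hd (tableau_insert x T)))"
    using assms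
  proof (induction x T rule: tableau_insert.induct)
    case (2 x t T)
    obtain b t' where t': "row_insert x t = (b, t')" by fastforce
    have "sorted t'" using 2(2) t' sorted_row_insert by (auto simp: tableau_Cons)
    show ?case
    proof (cases b)
      case None
      then show ?thesis
        using 2(2) t' \<open>sorted t'\<close> dominates_row_insert[OF t'] dominates_bump
        by (fastforce simp: tableau_Cons)
    next
      case (Some y)
      have IH: "tableau (tableau_insert y T)"
          "T \<noteq> [] \<Longrightarrow> dominates t' (hd (tableau_insert y T))"
        using 2 t' Some by (auto simp: tableau_Cons)
      \<comment> \<open>This serves the case of empty \<open>T\<close>, where the bumped letter
        forms a new row.\<close>
      moreover have "dominates t' [y]"
        using t' Some dominates_bump[of x t y t' "[]"] 2(2) by (auto simp: tableau_Cons)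
      ultimately have "tableau (t' # tableau_insert y T)"
        using \<open>sorted t'\<close> by (cases T) (auto simp: tableau_Cons simp del: tableau_insert.simps(2))
      then show ?thesis using t' Some dominates_bump by (fastforce simp: tableau_Cons)
    qed
  qed (use dominates_bump in \<open>auto\<close>)
  then show ?thesis ..
qed

lemma tableau_insertion_tableau: "tableau (insertion_tableau w)"
  unfolding insertion_tableau_def
  by (induction w rule: rev_induct) (auto simp: tableau_tableau_insert)

lemma Nil_notin_tableau_insert: "[] \<notin> set T \<Longrightarrow> [] \<notin> set (tableau_insert x T)"
  by (induction x T rule: tableau_insert.induct)
    (auto split: prod.splits option.splits dest: row_insert_neq_Nil[OF sym])

lemma Nil_notin_insertion_tableau: "[] \<notin> set (insertion_tableau w)"
  unfolding insertion_tableau_def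
  by (induction w rule: rev_induct) (auto simp: Nil_notin_tableau_insert)

section \<open>Insertion as a sequence of Knuth moves\<close>

lemma plactic_Cons: "w \<approx> w' \<Longrightarrow> x # w \<approx> x # w'"
  using plactic_cong[of w w' "[x]" "[]"] by simp

text \<open>The letter \<open>x\<close> moves left by \<open>knuth1\<close>; the witness is the left
  neighbour of the letter being passed.\<close>

lemma plactic_bump_first:
  "sorted (y # t) \<Longrightarrow> x < y \<Longrightarrow> y # t @ [x] \<approx> y # x # t"
proof (induction t arbitrary: y)
  case (Cons z t)
  then have "y # (z # t @ [x]) \<approx> y # (z # x # t)"
    by (intro plactic_Cons Cons.IH) auto
  also have "\<dots> \<approx> y # x # z # t"
    using plactic_cong[OF plactic_sym[OF knuth1[of x y z]], of "[]" t] Cons.prems by simp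
  finally show ?case by simp
qed simp

lemma plactic_row_insert:
  "row_insert x t = (Some y, t') \<Longrightarrow> sorted t \<Longrightarrow> t @ [x] \<approx> y # t'"
proof (induction t arbitrary: t')
  case (Cons a t)
  show ?case
  proof (cases "x < a")
    case True
    then show ?thesis using Cons.prems plactic_bump_first[of a t x] by simp
  next
    case False
    then obtain t1 where t1: "row_insert x t = (Some y, t1)" "t' = a # t1"
      using Cons.prems by (auto split: prod.splits)
    \<comment> \<open>The new head \<open>b\<close> of the rest is the witness with which
      \<open>knuth2\<close> moves \<open>y\<close> past \<open>a\<close>.\<close>
    then obtain b t2 where t2: "t1 = b # t2" "a \<le> b" "b < y"
      using False Cons.prems(2) row_insert_bumped[OF t1(1)]
      by (cases t) (auto split: prod.splits if_splits)
    have "(a # t) @ [x] \<approx> a # y # t1"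
      using Cons t1 by (auto intro: plactic_Cons)
    also have "\<dots> \<approx> y # a # t1"
      using plactic_cong[OF knuth2[of a b y], of "[]" t2] t2 by simp
    finally show ?thesis using t1 by simp
  qed
qed simp

lemma plactic_tableau_insert:
  "tableau T \<Longrightarrow> reading (tableau_insert x T) \<approx> reading T @ [x]"
proof (induction x T rule: tableau_insert.induct)
  case (2 x t T)
  obtain b t' where t': "row_insert x t = (b, t')" by fastforce
  show ?case
  proof (cases b)
    case None
    then show ?thesis using t' row_insert_None by auto
  next
    case (Some y)
    have "reading (tableau_insert y T) @ t' \<approx> (reading T @ [y]) @ t'"
      using 2 t' Some by (intro plactic_append) (auto simp: tableau_Cons)
    also have "\<dots> \<approx> reading T @ t @ [x]"
      using plactic_row_insert[of x t y t'] 2(2) t' Some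
      by (auto simp: tableau_Cons intro!: plactic_append intro: plactic_sym)
    finally show ?thesis using t' Some by simp
  qed
qed simp

lemma plactic_reading: "reading (insertion_tableau w) \<approx> w"
proof (induction w rule: rev_induct)
  case (snoc x w)
  have "reading (insertion_tableau (w @ [x])) \<approx> reading (insertion_tableau w) @ [x]"
    using plactic_tableau_insert[OF tableau_insertion_tableau[of w]]
    by (simp add: insertion_tableau_def)
  also have "\<dots> \<approx> w @ [x]"
    using snoc by (intro plactic_append) auto
  finally show ?case .
qed (simp add: insertion_tableau_def)

section \<open>Greene's theorem\<close>

text \<open>A weakly increasing chain meets the strictly decreasing letters of one label at most
  once, so \<open>r\<close> chains cover at most \<open>r\<close> letters of each label. In
  \<open>lw\<close> the label comes first and the letter second.\<close>

lemma greene_le_cover: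
  assumes dec: "sorted_wrt (\<lambda>p q. fst p = fst q \<longrightarrow> snd q < snd p) lw"
    and S: "finite S" "fst ` set lw \<subseteq> S"
  shows "greene r (map snd lw) \<le> (\<Sum>l\<in>S. min r (length (filter (\<lambda>p. fst p = l) lw)))"
proof (rule greene_leI)
  fix cs assume cs: "map fst cs = map snd lw" and ch: "chains r cs"
  let ?n = "length lw"
  have len: "length cs = ?n" using arg_cong[OF cs, of length] by simp
  have val: "fst (cs ! i) = snd (lw ! i)" if "i < ?n" for i
    using that cs len by (metis nth_map)
  let ?U = "{i. i < ?n \<and> snd (cs ! i) < r}"
  have "used r cs = card ?U"
    by (simp add: used_def length_filter_conv_card len)
  also have "\<dots> = (\<Sum>l\<in>S. card {i \<in> ?U. fst (lw ! i) = l})"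
    unfolding card_eq_sum by (rule sum.group[symmetric]) (use S in auto)
  also have "\<dots> \<le> (\<Sum>l\<in>S. min r (length (filter (\<lambda>p. fst p = l) lw)))"
  proof (rule sum_mono)
    fix l assume "l \<in> S"
    let ?V = "{i \<in> ?U. fst (lw ! i) = l}"
    have "inj_on (\<lambda>i. snd (cs ! i)) ?V"
    proof (rule linorder_inj_onI')
      fix i j assume ij: "i \<in> ?V" "j \<in> ?V" "i < j"
      then have "snd (lw ! j) < snd (lw ! i)"
        using sorted_wrt_nth_less[OF dec, of i j] by auto
      then show "snd (cs ! i) \<noteq> snd (cs ! j)"
        using sorted_wrt_nth_less[OF ch[unfolded chains_def], of i j] ij val[of i] val[of j] len by auto
    qed
    then have "card ?V \<le> card {..<r}"
      by (rule card_inj_on_le) auto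
    moreover have "card ?V \<le> card {i. i < ?n \<and> fst (lw ! i) = l}"
      by (rule card_mono) auto
    ultimately show "card ?V \<le> min r (length (filter (\<lambda>p. fst p = l) lw))"
      by (simp add: length_filter_conv_card)
  qed
  finally show "used r cs \<le> (\<Sum>l\<in>S. min r (length (filter (\<lambda>p. fst p = l) lw)))" .
qed

lemma dominates_iff_nth:
  "dominates t s \<longleftrightarrow> length s \<le> length t \<and> (\<forall>j<length s. t ! j < s ! j)"
  by (induction t s rule: dominates.induct) (auto simp: less_Suc_eq_0_disj)

text \<open>Columns read from the bottom up decrease strictly, so these labels give the cover wanted
  by \<open>greene_le_cover\<close>.\<close>

fun col_labelled :: "nat list list \<Rightarrow> (nat \<times> nat) list" where
  "col_labelled [] = []"
| "col_labelled (t # T) = col_labelled T @ zip [0..<length t] t"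

lemma map_snd_col_labelled: "map snd (col_labelled T) = reading T"
  by (induction T) auto

lemma col_labelled_above:
  "tableau (t # T) \<Longrightarrow> (j, v) \<in> set (col_labelled T) \<Longrightarrow> j < length t \<and> t ! j < v"
proof (induction T arbitrary: t)
  case (Cons s T)
  have "length s \<le> length t" "\<And>j. j < length s \<Longrightarrow> t ! j < s ! j"
    using Cons.prems(1) by (auto simp: dominates_iff_nth)
  moreover have "j < length s \<and> s ! j \<le> v"
    using Cons by (fastforce simp: set_zip)
  ultimately show ?case by force
qed simp

lemma col_labelled_decreasing:
  "tableau T \<Longrightarrow> sorted_wrt (\<lambda>p q. fst p = fst q \<longrightarrow> snd q < snd p) (col_labelled T)"
proof (induction T)
  case (Cons t T)
  have "sorted_wrt (\<lambda>p q. fst p = fst q \<longrightarrow> snd q < snd p) (zip [0..<length t] t)"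
    by (auto simp: sorted_wrt_iff_nth_less)
  then show ?case
    using Cons col_labelled_above[OF Cons.prems]
    by (fastforce simp: sorted_wrt_append tableau_Cons set_zip)
qed simp

lemma tableau_length_mono: "tableau (t # T) \<Longrightarrow> s \<in> set T \<Longrightarrow> length s \<le> length t"
proof (induction T arbitrary: t)
  case (Cons a T)
  then have "length a \<le> length t" by (simp add: dominates_iff_nth)
  then show ?case using Cons by (force simp: tableau_Cons)
qed simp

text \<open>Row lengths decrease weakly, so the rows that reach column \<open>l\<close> form an
  initial segment.\<close>

lemma min_count_rows_le:
  "tableau T \<Longrightarrow> min r (length (filter (\<lambda>t. l < length t) T)) \<le> length (filter (\<lambda>t. l < length t) (take r T))"
proof (induction T arbitrary: r)
  case (Cons t T)
  show ?case
  proof (cases "l < length t")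
    case True
    then show ?thesis using Cons by (cases r) (auto simp: tableau_Cons)
  next
    case False
    then have "filter (\<lambda>t. l < length t) T = []"
      using tableau_length_mono[OF Cons.prems] by (force simp: filter_empty_conv)
    with False show ?thesis by simp
  qed
qed simp

text \<open>With row numbers as colours, the first \<open>r\<close> rows are the optimal
  \<open>r\<close> chains.\<close>

fun row_coloured :: "nat \<Rightarrow> nat list list \<Rightarrow> (nat \<times> nat) list" where
  "row_coloured n [] = []"
| "row_coloured n (t # T) = row_coloured (Suc n) T @ map (\<lambda>x. (x, n)) t"

lemma map_fst_row_coloured: "map fst (row_coloured n T) = reading T"
  by (induction T arbitrary: n) (auto simp: comp_def)

lemma row_coloured_ge: "(l, e) \<in> set (row_coloured n T) \<Longrightarrow> n \<le> e"
  by (induction T arbitrary: n) (auto dest: Suc_leD)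

lemma chains_row_coloured: "tableau T \<Longrightarrow> chains r (row_coloured n T)"
proof (induction T arbitrary: n)
  case (Cons t T)
  have "chains r (map (\<lambda>x. (x, n)) t)"
    using Cons.prems by (auto simp: tableau_Cons chains_def sorted_wrt_map intro: sorted_wrt_mono_rel)
  then show ?case
    using Cons row_coloured_ge[of _ _ "Suc n" T] by (fastforce simp: chains_append tableau_Cons)
qed simp

lemma used_row_coloured: "used r (row_coloured n T) = sum_list (map length (take (r - n) T))"
proof (induction T arbitrary: n)
  case (Cons t T)
  have "used r (map (\<lambda>x. (x, n)) t) = (if n < r then length t else 0)"
    by (simp add: used_def)
  then show ?case using Cons[of "Suc n"]
    by (cases "r - n") (auto simp: diff_Suc split: nat.splits)
qed simp

lemma greene_reading:
  assumes T: "tableau T"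
  shows "greene r (reading T) = sum_list (map length (take r T))"
proof (rule antisym)
  show "sum_list (map length (take r T)) \<le> greene r (reading T)"
    using used_le_greene[OF chains_row_coloured[OF T], of r 0]
    by (simp add: used_row_coloured map_fst_row_coloured)
  define L where "L = sum_list (map length T)"
  have L: "length t \<le> L" if "t \<in> set T" for t
    using that unfolding L_def by (simp add: member_le_sum_list)
  have count: "length (filter (\<lambda>p. fst p = l) (col_labelled T)) = length (filter (\<lambda>t. l < length t) T)" for l
  proof (induction T)
    case (Cons t T)
    have "length (filter (\<lambda>p. fst p = l) (zip [0..<length t] t)) = (if l < length t then 1 else 0)"
      by (simp add: length_filter_conv_card conj_commute cong: conj_cong)
    with Cons show ?case by simp
  qed simp
  have "\<exists>t\<in>set T. j < length t" if "(j, v) \<in> set (col_labelled T)" for j v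
    using that by (induction T) (auto simp: set_zip)
  then have "fst ` set (col_labelled T) \<subseteq> {..<L}"
    using L by (fastforce intro: less_le_trans)
  from greene_le_cover[OF col_labelled_decreasing[OF T] _ this, of r]
  have "greene r (reading T) \<le> (\<Sum>l<L. min r (length (filter (\<lambda>t. l < length t) T)))"
    by (simp add: count map_snd_col_labelled)
  also have "\<dots> \<le> (\<Sum>l<L. length (filter (\<lambda>t. l < length t) (take r T)))"
    by (intro sum_mono min_count_rows_le T)
  \<comment> \<open>The cells of the first \<open>r\<close> rows are counted by columns and by
    rows.\<close>
  also have "\<dots> = sum_list (map length (take r T))"
  proof -
    have "(\<Sum>l<L. length (filter (\<lambda>t. l < length t) R)) = sum_list (map length R)"
      if "\<forall>t\<in>set R. length t \<le> L" for R :: "nat list list"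
      using that
    proof (induction R)
      case (Cons t R)
      have "(\<Sum>l<L. length (filter (\<lambda>t. l < length t) (t # R)))
          = (\<Sum>l<L. (if l < length t then 1 else 0) + length (filter (\<lambda>t. l < length t) R))"
        by (intro sum.cong) auto
      also have "\<dots> = card ({..<L} \<inter> {..<length t}) + sum_list (map length R)"
        using Cons by (simp add: sum.distrib sum.If_cases lessThan_def)
      also have "{..<L} \<inter> {..<length t} = {..<length t}"
        using Cons.prems by auto
      finally show ?case by simp
    qed simp
    then show ?thesis using L in_set_takeD by metis
  qed
  finally show "greene r (reading T) \<le> sum_list (map length (take r T))" .
qed

section \<open>Tableaux are determined by Greene numbers of restrictions\<close>

lemma dominates_filter:
  "sorted s \<Longrightarrow> dominates t s \<Longrightarrow> dominates (filter (\<lambda>l. l \<le> i) t) (filter (\<lambda>l. l \<le> i) s)"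
proof (induction t s rule: dominates.induct)
  case (3 a t b s)
  show ?case
  proof (cases "b \<le> i")
    case True
    with 3 show ?thesis by auto
  next
    case False
    then have "filter (\<lambda>l. l \<le> i) (b # s) = []"
      using 3 by (auto simp: filter_empty_conv)
    then show ?thesis by (simp only: dominates.simps)
  qed
qed auto

lemma tableau_filter: "tableau T \<Longrightarrow> tableau (map (filter (\<lambda>l. l \<le> i)) T)"
  by (induction T rule: tableau.induct) (auto intro: dominates_filter simp: tableau_Cons intro: sorted_wrt_filter)

lemma filter_reading: "filter f (reading T) = reading (map (filter f) T)"
  by (induction T) auto

lemma sorted_eqI:
  fixes t t' :: "nat list"
  assumes "sorted t" "sorted t'"
    and len: "\<And>i. length (filter (\<lambda>l. l \<le> i) t) = length (filter (\<lambda>l. l \<le> i) t')"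
  shows "t = t'"
proof -
  have split: "count (mset s) (Suc i) + length (filter (\<lambda>l. l \<le> i) s) = length (filter (\<lambda>l. l \<le> Suc i) s)"
    for s :: "nat list" and i by (induction s) (auto simp: le_Suc_eq)
  have zero: "count (mset s) 0 = length (filter (\<lambda>l. l \<le> 0) s)" for s :: "nat list"
    by (induction s) auto
  have "mset t = mset t'"
  proof (rule multiset_eqI)
    fix i show "count (mset t) i = count (mset t') i"
      using split[of t "i - 1"] split[of t' "i - 1"] zero[of t] zero[of t'] len[of i] len[of "i - 1"]
      by (cases i) auto
  qed
  then show ?thesis
    using assms(1,2) by (metis properties_for_sort)
qed

text \<open>Consecutive \<open>r\<close> give the number of letters up to \<open>i\<close> in each
  single row, and these numbers determine a sorted row. The sums do not see trailing empty rows,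
  hence their exclusion.\<close>

lemma tableau_eqI:
  assumes "tableau T" "tableau T'" "[] \<notin> set T" "[] \<notin> set T'"
    and "\<And>i r. sum_list (map (\<lambda>t. length (filter (\<lambda>l. l \<le> i) t)) (take r T))
             = sum_list (map (\<lambda>t. length (filter (\<lambda>l. l \<le> i) t)) (take r T'))"
  shows "T = T'"
  using assms
proof (induction T T' rule: list_induct2')
  case (2 t T)
  have "filter (\<lambda>l. l \<le> hd t) t \<noteq> []" using 2(3) by (cases t) auto
  then show ?case using 2(5)[of "hd t" 1] by simp
next
  case (3 t T)
  have "filter (\<lambda>l. l \<le> hd t) t \<noteq> []" using 3(4) by (cases t) auto
  then show ?case using 3(5)[of "hd t" 1] by simp
next
  case (4 t T t' T')
  have len: "length (filter (\<lambda>l. l \<le> i) t) = length (filter (\<lambda>l. l \<le> i) t')" for i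
    using "4.prems"(5)[of i 1] by simp
  then have "t = t'"
    using "4.prems"(1,2) by (intro sorted_eqI) (auto simp: tableau_Cons)
  moreover have "T = T'"
  proof (rule "4.IH")
    show "sum_list (map (\<lambda>t. length (filter (\<lambda>l. l \<le> i) t)) (take r T))
             = sum_list (map (\<lambda>t. length (filter (\<lambda>l. l \<le> i) t)) (take r T'))" for i r
      using "4.prems"(5)[of i "Suc r"] len[of i] by simp
  qed (use "4.prems" in \<open>auto simp: tableau_Cons\<close>)
  ultimately show ?case by simp
qed simp

lemma greene_filter:
  "greene r (filter (\<lambda>l. l \<le> i) w)
     = sum_list (map (\<lambda>t. length (filter (\<lambda>l. l \<le> i) t)) (take r (insertion_tableau w)))"
proof -
  have "filter (\<lambda>l. l \<le> i) (reading (insertion_tableau w)) \<approx> filter (\<lambda>l. l \<le> i) w"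
    by (intro plactic_filter plactic_reading) simp
  from greene_plactic[OF this, of r] show ?thesis
    by (simp add: filter_reading greene_reading tableau_filter tableau_insertion_tableau take_map comp_def)
qed

lemma insertion_tableau_eqI:
  assumes "\<And>i r. greene r (filter (\<lambda>l. l \<le> i) w) = greene r (filter (\<lambda>l. l \<le> i) w')"
  shows "insertion_tableau w = insertion_tableau w'"
  using assms
  by (intro tableau_eqI tableau_insertion_tableau Nil_notin_insertion_tableau) (simp flip: greene_filter)

text \<open>Knuth's theorem. A word is equivalent to the reading word of its tableau; conversely,
  the Greene numbers of restrictions are invariant and determine the tableau.\<close>

lemma insertion_tableau_eq_iff: "insertion_tableau w = insertion_tableau w' \<longleftrightarrow> w \<approx> w'"
proof
  assume "insertion_tableau w = insertion_tableau w'"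
  then show "w \<approx> w'" by (metis plactic_reading plactic_sym plactic_trans)
next
  assume "w \<approx> w'"
  then show "insertion_tableau w = insertion_tableau w'"
    by (intro insertion_tableau_eqI greene_plactic plactic_filter) simp_all
qed

lemma placticI:
  assumes "\<And>i r. greene r (filter (\<lambda>l. l \<le> i) w) = greene r (filter (\<lambda>l. l \<le> i) w')"
  shows "w \<approx> w'"
  using insertion_tableau_eqI[OF assms] insertion_tableau_eq_iff by blast

text \<open>Letters grow by at least 1 from row to row down each column, as the colours do.\<close>

lemma row_coloured_gt:
  "tableau T \<Longrightarrow> \<forall>x\<in>set (hd T). n < x \<Longrightarrow> (l, e) \<in> set (row_coloured n T) \<Longrightarrow> e < l"
proof (induction T arbitrary: n)
  case (Cons t T)
  show ?case
  proof (cases "(l, e) \<in> set (row_coloured (Suc n) T)")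
    case True
    then have "T \<noteq> []" by auto
    then have dom: "length (hd T) \<le> length t" "\<And>j. j < length (hd T) \<Longrightarrow> t ! j < hd T ! j"
      using Cons.prems(1) by (auto simp: tableau_Cons dominates_iff_nth)
    have "Suc n < hd T ! j" if "j < length (hd T)" for j
      using dom(2)[OF that] dom(1) Cons.prems(2) that
      by (metis Suc_lessI less_le_trans less_trans_Suc list.sel(1) nth_mem)
    then have "\<forall>x\<in>set (hd T). Suc n < x"
      by (metis in_set_conv_nth)
    with Cons True show ?thesis by (auto simp: tableau_Cons)
  next
    case False
    then show ?thesis using Cons.prems by auto
  qed
qed simp

text \<open>After replacing \<open>x\<close> by the reading word of its tableau, row
  \<open>e\<close> has only letters above \<open>e\<close>, so all copies of \<open>e + 1\<close> in
  \<open>v\<close> can be put in front of it.\<close>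

lemma greene_prefix:
  assumes "0 \<notin> set v" "0 \<notin> set x"
  shows "length (filter (\<lambda>l. l \<le> r) v) + greene r x \<le> greene r (v @ x)"
proof -
  let ?T = "insertion_tableau x" and ?v = "map (\<lambda>l. (l, l - 1)) v"
  have T: "tableau ?T" by (rule tableau_insertion_tableau)
  have "set (reading ?T) = set x"
    using plactic_mset[OF plactic_reading[of x]] by (metis mset_eq_setD)
  then have pos: "0 < l" if "l \<in> set (hd ?T)" "?T \<noteq> []" for l
    using that assms(2) by (cases ?T) (auto simp: reading_def intro: gr0I)
  have gt: "e < l" if "(l, e) \<in> set (row_coloured 0 ?T)" for l e
    using row_coloured_gt[OF T _ that] pos that by (cases "?T = []") auto
  have "chains r ?v"
    using assms(1)
  proof (induction v)
    case (Cons a v)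
    then have "a = b" if "b \<in> set v" "a - 1 = b - 1" for b
      using that by (metis One_nat_def Suc_pred bot_nat_0.not_eq_extremum list.set_intros)
    with Cons show ?case by (fastforce simp: chains_Cons)
  qed simp
  then have "chains r (?v @ row_coloured 0 ?T)"
    using gt chains_row_coloured[OF T] by (force simp: chains_append)
  from used_le_greene[OF this]
  have "used r ?v + greene r (reading ?T) \<le> greene r (v @ reading ?T)"
    by (simp add: map_fst_row_coloured used_row_coloured greene_reading[OF T] comp_def)
  moreover have "used r ?v = length (filter (\<lambda>l. l \<le> r) v)"
    using assms(1) by (induction v) auto
  ultimately show ?thesis
    using greene_plactic[OF plactic_reading[of x]]
      greene_plactic[OF plactic_append[OF plactic_refl plactic_reading[of x]]] by metis
qed

section \<open>Full columns and the letters above them\<close>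

definition column :: "nat \<Rightarrow> nat list" where
  "column m = rev [1..<Suc m]"

lemma length_column [simp]: "length (column m) = m"
  by (simp add: column_def)

lemma set_column [simp]: "set (column m) = {1..m}"
  by (auto simp: column_def)

lemma column_Suc: "column (Suc m) = Suc m # column m"
  by (simp add: column_def)

lemma filter_column: "filter (\<lambda>l. l \<le> i) (column m) = column (min i m)"
proof (induction m)
  case (Suc m)
  then show ?case by (auto simp: column_Suc min_def le_Suc_eq)
qed (simp add: column_def)

lemma sorted_wrt_column: "sorted_wrt (\<lambda>x y. y < x) (column m)"
  by (simp add: column_def sorted_wrt_rev del: upt_Suc)

lemma greene_column_le: "greene r (column m) \<le> min r m"
proof -
  have "sorted_wrt (\<lambda>p q. fst p = fst q \<longrightarrow> snd q < snd p) (map (Pair (0::nat)) (column m))"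
    by (simp add: sorted_wrt_map sorted_wrt_column)
  moreover have "fst ` set (map (Pair (0::nat)) (column m)) \<subseteq> {0}" by auto
  ultimately show ?thesis
    using greene_le_cover[of "map (Pair (0::nat)) (column m)" "{0}" r]
    by (simp add: comp_def filter_map)
qed

lemma greene_column_prefix:
  assumes "0 \<notin> set x"
  shows "greene r (column m @ x) = min r m + greene r x"
proof (rule antisym)
  show "greene r (column m @ x) \<le> min r m + greene r x"
    using greene_append_le[of r "column m" x] greene_column_le[of r m] by linarith
  show "min r m + greene r x \<le> greene r (column m @ x)"
    using greene_prefix[of "column m" x r] assms by (simp add: filter_column)
qed

text \<open>Reversing and complementing maps chains to chains. As an involution fixing
  \<open>column m\<close>, it turns results on prefixes into results on suffixes.\<close>

lemma greene_rev_complement: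
  assumes "set x \<subseteq> {1..m}"
  shows "greene r x \<le> greene r (rev (map (\<lambda>l. Suc m - l) x))"
proof (rule greene_leI)
  fix cs assume cs: "map fst cs = x" "chains r cs"
  let ?cs = "rev (map (\<lambda>(l, c). (Suc m - l, c)) cs)"
  have "chains r ?cs"
    using cs(2) unfolding chains_def sorted_wrt_rev sorted_wrt_map
    by (rule sorted_wrt_mono_rel[rotated]) auto
  moreover have "used r ?cs = used r cs"
    by (simp add: used_def filter_map comp_def case_prod_beta flip: rev_filter)
  moreover have "map fst ?cs = rev (map (\<lambda>l. Suc m - l) x)"
    by (simp add: rev_map comp_def case_prod_beta flip: cs(1))
  ultimately show "used r cs \<le> greene r (rev (map (\<lambda>l. Suc m - l) x))"
    by (metis used_le_greene)
qed

lemma greene_column_suffix: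
  assumes x: "set x \<subseteq> {1..m}"
  shows "greene r (x @ column m) = min r m + greene r x"
proof (rule antisym)
  show "greene r (x @ column m) \<le> min r m + greene r x"
    using greene_append_le[of r x "column m"] greene_column_le[of r m] by linarith
  let ?rc = "\<lambda>w. rev (map (\<lambda>l. Suc m - l) w)"
  have col: "?rc (column m) = column m"
    by (rule nth_equalityI) (auto simp: column_def rev_nth simp del: upt_Suc)
  have inv: "?rc (?rc x) = x"
    using x by (auto simp: rev_map comp_def intro!: map_idI)
  have rcx: "set (?rc x) \<subseteq> {1..m}"
    using x by force
  have "min r m + greene r x \<le> min r m + greene r (?rc x)"
    using greene_rev_complement[OF x] by simp
  also have "\<dots> = greene r (column m @ ?rc x)"
    using rcx by (subst greene_column_prefix) auto
  also have "\<dots> \<le> greene r (?rc (column m @ ?rc x))"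
    using rcx by (intro greene_rev_complement) auto
  also have "?rc (column m @ ?rc x) = x @ column m"
    using col inv by simp
  finally show "min r m + greene r x \<le> greene r (x @ column m)" .
qed

text \<open>On either side the column adds the same number to each Greene number, also after
  restriction, which only shortens it.\<close>

lemma column_central:
  assumes x: "set x \<subseteq> {1..m}"
  shows "column m @ x \<approx> x @ column m"
proof (rule placticI)
  fix i r
  have "set (filter (\<lambda>l. l \<le> i) x) \<subseteq> {1..min i m}"
    using x by auto
  moreover have "0 \<notin> set x"
    using x by auto
  ultimately show "greene r (filter (\<lambda>l. l \<le> i) (column m @ x))
      = greene r (filter (\<lambda>l. l \<le> i) (x @ column m))"
    by (simp only: filter_append filter_column greene_column_suffix) (simp add: greene_column_prefix)
qed

lemma column_cancel:
  assumes "0 \<notin> set x" "0 \<notin> set y" "column m @ x \<approx> column m @ y"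
  shows "x \<approx> y"
proof (rule placticI)
  fix i r
  have "filter (\<lambda>l. l \<le> i) (column m @ x) \<approx> filter (\<lambda>l. l \<le> i) (column m @ y)"
    using assms(3) by (rule plactic_filter) simp
  from greene_plactic[OF this, of r]
  show "greene r (filter (\<lambda>l. l \<le> i) x) = greene r (filter (\<lambda>l. l \<le> i) y)"
    using assms by (simp add: filter_column greene_column_prefix)
qed

lemma nth_row_coloured: "e < length T \<Longrightarrow> l \<in> set (T ! e) \<Longrightarrow> (l, n + e) \<in> set (row_coloured n T)"
proof (induction T arbitrary: n e)
  case (Cons t T)
  then show ?case using Cons.IH[of "e - 1" "Suc n"] by (cases e) auto
qed simp

text \<open>The hypothesis says that the first \<open>m\<close> rows of the tableau of \<open>z\<close> contain no letter
  above \<open>m\<close>.\<close>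

lemma plactic_split_letters:
  assumes pos: "0 \<notin> set z" and le: "greene m z \<le> length (filter (\<lambda>l. l \<le> m) z)"
  shows "z \<approx> filter (\<lambda>l. m < l) z @ filter (\<lambda>l. l \<le> m) z"
proof -
  let ?T = "insertion_tableau z"
  let ?top = "reading (take m ?T)" and ?bot = "reading (drop m ?T)"
  have T: "tableau ?T" by (rule tableau_insertion_tableau)
  have R: "reading ?T = ?bot @ ?top"
    by (metis append_take_drop_id concat_append reading_def rev_append)
  have mset: "mset (reading ?T) = mset z"
    by (rule plactic_mset[OF plactic_reading])
  then have "0 \<notin> set (reading ?T)"
    using pos by (metis mset_eq_setD)
  then have "0 < l" if "l \<in> set (hd ?T)" "?T \<noteq> []" for l
    using that by (cases ?T) (auto intro: gr0I)
  then have "e < l" if "e < length ?T" "l \<in> set (?T ! e)" for e l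
    using row_coloured_gt[OF T, of 0 l e] nth_row_coloured[OF that, of 0] that
    by (cases "?T = []") auto
  then have gt: "e < l" if "e < length ?T" "l \<in> set (?T ! e)" for e l
    using that by blast
  have bot: "m < l" if l: "l \<in> set ?bot" for l
  proof -
    obtain t where "t \<in> set (drop m ?T)" "l \<in> set t"
      using l by (auto simp: reading_def)
    then obtain e where "e < length ?T - m" "l \<in> set (?T ! (m + e))"
      by (auto simp: in_set_conv_nth[of t])
    then show ?thesis using gt[of "m + e" l] by (simp add: less_diff_conv add.commute)
  qed
  \<comment> \<open>All letters up to \<open>m\<close> lie in the top rows, and by \<open>le\<close>
    these have no room for others.\<close>
  have "length (filter (\<lambda>l. l \<le> m) ?top) = length (filter (\<lambda>l. l \<le> m) (reading ?T))"
    using bot by (force simp: R filter_empty_conv)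
  also have "\<dots> = length (filter (\<lambda>l. l \<le> m) z)"
    using mset by (metis mset_filter size_mset)
  also have "\<dots> \<ge> length ?top"
    using le greene_plactic[OF plactic_reading[of z], of m] unfolding greene_reading[OF T]
    by (simp add: reading_def length_concat sum_list_rev rev_map[symmetric])
  finally have "length ?top \<le> length (filter (\<lambda>l. l \<le> m) ?top)" .
  then have top: "l \<le> m" if "l \<in> set ?top" for l
    using that by (metis length_filter_less not_le)
  have fl: "filter (\<lambda>l. m < l) (reading ?T) = ?bot" "filter (\<lambda>l. l \<le> m) (reading ?T) = ?top"
    using bot top by (simp_all add: R filter_id_conv filter_empty_conv not_less not_le)
  have "z \<approx> reading ?T" by (rule plactic_sym[OF plactic_reading])
  also have "\<dots> = filter (\<lambda>l. m < l) (reading ?T) @ filter (\<lambda>l. l \<le> m) (reading ?T)"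
    unfolding fl by (rule R)
  also have "\<dots> \<approx> filter (\<lambda>l. m < l) z @ filter (\<lambda>l. l \<le> m) z"
    by (intro plactic_append plactic_filter plactic_reading) simp_all
  finally show ?thesis .
qed

text \<open>If \<open>m\<close> chains cover all of the final column, then each of them ends with a letter of that
  column, so no letter above \<open>m\<close> is covered.\<close>

lemma greene_column_suffix_big:
  assumes "m + greene m w \<le> greene m (w @ column m)"
  shows "greene m w \<le> length (filter (\<lambda>l. l \<le> m) w)"
proof -
  obtain cs where "map fst cs = w @ column m" and ch: "chains m cs"
    and us: "used m cs = greene m (w @ column m)"
    by (rule greene_attained)
  then obtain a b where ab: "cs = a @ b" "map fst a = w" "map fst b = column m"
    by (auto simp: map_eq_append_conv)
  have len: "length b = m" using arg_cong[OF ab(3), of length] by simp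
  have "used m a \<le> greene m w"
    using used_le_greene[of m a] ch ab by (simp add: chains_append)
  moreover have "used m b \<le> m" using used_le_length[of m b] len by simp
  ultimately have full: "used m b = m" and ua: "used m a = greene m w"
    using us assms ab by simp_all
  then have small: "snd p < m" if "p \<in> set b" for p
    using that len unfolding used_def by (metis length_filter_less less_irrefl)
  have "sorted_wrt (\<lambda>p q. fst q < fst p) b"
    using sorted_wrt_column[of m] by (simp add: sorted_wrt_map flip: ab(3))
  moreover have "sorted_wrt (\<lambda>p q. snd p = snd q \<longrightarrow> snd p < m \<longrightarrow> fst p \<le> fst q) b"
    using ch ab unfolding chains_append chains_def by (simp add: sorted_wrt_append)
  \<comment> \<open>The column decreases, so its \<open>m\<close> letters have distinct colours
    below \<open>m\<close>; every colour occurs.\<close>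
  ultimately have "sorted_wrt (\<lambda>p q. snd p \<noteq> snd q) b"
    using small by (auto simp: sorted_wrt_iff_nth_less) (metis leD less_trans nth_mem)
  then have "distinct (map snd b)"
    by (simp add: distinct_conv_nth sorted_wrt_iff_nth_less) (metis linorder_neqE_nat)
  then have "card (snd ` set b) = m"
    using len by (metis distinct_card length_map set_map)
  then have colours: "snd ` set b = {..<m}"
    using small by (intro card_subset_eq) auto
  have "l \<le> m" if l: "(l, c) \<in> set a" "c < m" for l c
  proof -
    obtain l' where l': "(l', c) \<in> set b"
      using colours l(2) by (metis (no_types, lifting) imageE lessThan_iff prod.collapse)
    then have "l' \<in> set (column m)" using ab(3) by (metis fst_conv image_eqI set_map)
    moreover have "l \<le> l'" using ch l l' ab by (auto simp: chains_append)
    ultimately show ?thesis by simp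
  qed
  then have "used m a \<le> length (filter (\<lambda>l. l \<le> m) (map fst a))"
  proof (induction a)
    case (Cons p a)
    then show ?case by (cases p) fastforce
  qed simp
  then show ?thesis using ua ab by simp
qed

text \<open>If \<open>w\<close> commutes with \<open>v\<close>, then \<open>greene_prefix\<close>
  for \<open>v @ w\<close> and subadditivity for \<open>w @ column m @ y\<close> show that the
  column adds fully behind \<open>w\<close>. Conversely, the letters above \<open>m\<close> can be
  moved to the front of both products, leaving \<open>v @ a\<close> and
  \<open>a @ v\<close>.\<close>

lemma commute_iff:
  assumes w: "0 \<notin> set w" and v: "set v \<subseteq> {1..m}" "v \<approx> column m @ y"
  defines "a \<equiv> filter (\<lambda>l. l \<le> m) w"
  shows "v @ w \<approx> w @ v \<longleftrightarrow> greene m w \<le> length a \<and> v @ a \<approx> a @ v"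
proof
  have fv: "filter (\<lambda>l. l \<le> m) v = v" "filter (\<lambda>l. m < l) v = []"
    using v(1) by (auto simp: filter_id_conv filter_empty_conv)
  have v0: "0 \<notin> set v" using v(1) by auto
  {
    assume comm: "v @ w \<approx> w @ v"
    then have "filter (\<lambda>l. l \<le> m) (v @ w) \<approx> filter (\<lambda>l. l \<le> m) (w @ v)"
      by (rule plactic_filter) simp
    then have 1: "v @ a \<approx> a @ v" by (simp add: fv a_def)
    have "length v = m + length y"
      using arg_cong[OF plactic_mset[OF v(2)], of size] by simp
    moreover have "length v + greene m w \<le> greene m (v @ w)"
      using greene_prefix[OF v0 w, of m] by (simp add: fv)
    moreover have "v @ w \<approx> (w @ column m) @ y"
      using comm plactic_append[OF plactic_refl v(2), of w] by (auto intro: plactic_trans)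
    then have "greene m (v @ w) \<le> greene m (w @ column m) + length y"
      using greene_plactic greene_append_le[of m "w @ column m" y] greene_le_length[of m y]
      by (metis add_left_mono le_trans)
    ultimately have "greene m w \<le> length a"
      unfolding a_def by (intro greene_column_suffix_big) linarith
    with 1 show "greene m w \<le> length a \<and> v @ a \<approx> a @ v" by simp
  }
  assume r: "greene m w \<le> length a \<and> v @ a \<approx> a @ v"
  let ?b = "filter (\<lambda>l. m < l) w"
  \<comment> \<open>Subadditivity bounds \<open>greene m (v @ w)\<close> by
    \<open>length v + length a\<close>, the number of letters up to \<open>m\<close>.\<close>
  have "v @ w \<approx> ?b @ (v @ a)"
    using plactic_split_letters[of "v @ w" m] v0 w r
      greene_append_le[of m v w] greene_le_length[of m v] by (simp add: fv a_def)
  also have "\<dots> \<approx> ?b @ (a @ v)"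
    by (rule plactic_append) (use r in auto)
  also have "\<dots> \<approx> w @ v"
    using plactic_split_letters[of "w @ v" m, THEN plactic_sym] v0 w r
      greene_append_le[of m w v] greene_le_length[of m v] by (simp add: fv a_def)
  finally show "v @ w \<approx> w @ v" .
qed

lemma commute_column_iff:
  assumes "set v \<subseteq> {1..m}" "set a \<subseteq> {1..m}" "v' \<approx> column m @ v"
  shows "v' @ a \<approx> a @ v' \<longleftrightarrow> v @ a \<approx> a @ v"
proof -
  have 1: "v' @ a \<approx> column m @ (v @ a)"
    using plactic_append[OF assms(3) plactic_refl, of a] by simp
  have "a @ v' \<approx> (a @ column m) @ v"
    using plactic_append[OF plactic_refl assms(3), of a] by simp
  also have "\<dots> \<approx> (column m @ a) @ v"
    by (intro plactic_append plactic_sym[OF column_central] assms plactic_refl)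
  finally have 2: "a @ v' \<approx> column m @ (a @ v)" by simp
  have "0 \<notin> set (v @ a)" "0 \<notin> set (a @ v)" using assms by auto
  then have "column m @ (v @ a) \<approx> column m @ (a @ v) \<longleftrightarrow> v @ a \<approx> a @ v"
    by (meson column_cancel plactic_append plactic_refl)
  with 1 2 show ?thesis by (meson plactic_sym plactic_trans)
qed

section \<open>Powers of a permutation\<close>

lemma word_power_0 [simp]: "word_power u 0 = []"
  by (simp add: word_power_def)

lemma word_power_Suc: "word_power u (Suc k) = word_power u k @ u"
  by (simp add: word_power_def flip: replicate_append_same)

lemma filter_word_power: "filter f (word_power u k) = word_power (filter f u) k"
  by (induction k) (simp_all add: word_power_Suc)

lemma set_word_power: "set (word_power u k) \<subseteq> set u"
  by (induction k) (auto simp: word_power_Suc)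

lemma length_word_power: "length (word_power u k) = k * length u"
  by (induction k) (auto simp: word_power_Suc)

text \<open>The number \<open>p i\<close> stands for the position of the letter \<open>i\<close> in \<open>u\<close>.\<close>

locale permutation_word =
  fixes m :: nat and u :: "nat list" and p :: "nat \<Rightarrow> nat"
  assumes set_u: "set u = {1..m}"
    and positions: "sorted_wrt (\<lambda>i j. p i < p j) u"
begin

text \<open>Those \<open>j\<close> for which \<open>j + 1\<close> stands to the right of
  \<open>j\<close> in \<open>u\<close>: the ascents of the inverse permutation.\<close>

definition ascents :: "nat set" where
  "ascents = {j \<in> {1..<m}. p j < p (Suc j)}"

definition rank :: "nat \<Rightarrow> nat" where
  "rank i = card (ascents \<inter> {..<i})"

text \<open>Pairing each letter with its copy number makes the letters of the power
  distinct.\<close>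

definition occurrences :: "nat \<Rightarrow> (nat \<times> nat) list" where
  "occurrences k = concat (map (\<lambda>t. map (Pair t) u) [0..<k])"

text \<open>For \<open>r \<le> m\<close>, the bound of \<open>greene_le_cover\<close> for
  \<open>k - card ascents\<close> full columns and two pieces of sizes \<open>j\<close> and
  \<open>m - j\<close> per ascent. From \<open>k = card ascents\<close> on, it grows by
  \<open>r\<close> with each copy.\<close>

definition stable_greene :: "nat \<Rightarrow> nat \<Rightarrow> nat" where
  "stable_greene r k = r * (k - card ascents) + (\<Sum>j\<in>ascents. min r j + min r (m - j))"

lemma finite_ascents [simp]: "finite ascents"
  by (simp add: ascents_def)

lemma ascentsD: "j \<in> ascents \<Longrightarrow> 1 \<le> j \<and> j < m"
  by (simp add: ascents_def)

lemma card_ascents_le: "m \<le> Suc k \<Longrightarrow> card ascents \<le> k"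
  using card_mono[of "{1..<m}" ascents] by (force simp: ascents_def)

lemma distinct_u: "distinct u"
  using positions by (auto simp: distinct_conv_nth sorted_wrt_iff_nth_less) (metis less_irrefl linorder_neqE_nat)

lemma map_snd_occurrences: "map snd (occurrences k) = word_power u k"
  by (induction k) (auto simp: occurrences_def word_power_Suc comp_def)

lemma set_occurrences: "set (occurrences k) = {..<k} \<times> {1..m}"
  using set_u by (auto simp: occurrences_def)

lemma distinct_occurrences: "distinct (occurrences k)"
proof (induction k)
  case (Suc k)
  have "distinct (map (Pair k) u)" by (simp add: distinct_map distinct_u inj_on_def)
  moreover have "set (occurrences k) \<inter> set (map (Pair k) u) = {}"
    using set_occurrences[of k] by auto
  ultimately show ?case using Suc by (simp add: occurrences_def)
qed (simp add: occurrences_def)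

lemma length_filter_occurrences:
  "length (filter P (occurrences k)) = card {x \<in> {..<k} \<times> {1..m}. P x}"
  by (subst distinct_card[symmetric]) (auto simp: distinct_occurrences set_occurrences intro: arg_cong[where f = card])

lemma sorted_wrt_occurrences:
  assumes "\<And>t t' i i'. t < t' \<Longrightarrow> i \<in> {1..m} \<Longrightarrow> i' \<in> {1..m} \<Longrightarrow> R (t, i) (t', i')"
    and "\<And>t i i'. i \<in> {1..m} \<Longrightarrow> i' \<in> {1..m} \<Longrightarrow> p i < p i' \<Longrightarrow> R (t, i) (t, i')"
  shows "sorted_wrt R (occurrences k)"
proof (induction k)
  case (Suc k)
  have "sorted_wrt (\<lambda>i i'. R (k, i) (k, i')) u"
    by (rule sorted_wrt_mono_rel[OF _ positions]) (use assms(2) set_u in auto)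
  then have "sorted_wrt R (map (Pair k) u)"
    by (simp add: sorted_wrt_map)
  moreover have "\<forall>x\<in>set (occurrences k). \<forall>y\<in>set (map (Pair k) u). R x y"
    using assms(1) set_u by (auto simp: set_occurrences)
  moreover have "occurrences (Suc k) = occurrences k @ map (Pair k) u"
    by (simp add: occurrences_def)
  ultimately show ?case using Suc by (simp add: sorted_wrt_append)
qed (simp add: occurrences_def)

section \<open>Upper bound for the Greene numbers of powers\<close>

lemma rank_mono: "i \<le> j \<Longrightarrow> rank i \<le> rank j"
  unfolding rank_def by (intro card_mono) auto

lemma rank_less: "j \<in> ascents \<Longrightarrow> j < i \<Longrightarrow> rank j < rank i"
  unfolding rank_def by (intro psubset_card_mono) auto

lemma rank_le: "rank i \<le> card ascents"
  unfolding rank_def by (intro card_mono) auto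

lemma bij_betw_rank: "bij_betw rank ascents {..<card ascents}"
proof -
  have inj: "inj_on rank ascents"
    by (rule linorder_inj_onI') (use rank_less in force)
  moreover have "rank j < card ascents" if "j \<in> ascents" for j
    unfolding rank_def using that by (intro psubset_card_mono) auto
  then have "rank ` ascents = {..<card ascents}"
    using card_image[OF inj] by (intro card_subset_eq) auto
  ultimately show ?thesis by (simp add: bij_betw_def)
qed

lemma rank_eq_imp_descending:
  assumes "1 \<le> i" "i \<le> j" "j \<le> m" "rank i = rank j"
  shows "p j \<le> p i"
  using assms(2-4)
proof (induction j rule: dec_induct)
  case (step j)
  have r: "rank i = rank j"
    using rank_mono[of i j] rank_mono[of j "Suc j"] step by simp
  then have "j \<notin> ascents"
    using rank_less[of j "Suc j"] step by auto
  then have "p (Suc j) \<le> p j"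
    using step assms(1) by (auto simp: ascents_def)
  then show ?case using step r by simp
qed simp

text \<open>Giving the letter \<open>i\<close> of the \<open>t\<close>-th copy of \<open>u\<close> the label \<open>t + rank i\<close> splits the word
  into decreasing subsequences: all but \<open>2 * card ascents\<close> of them are full columns, the
  others are \<open>j \<dots> 1\<close> and \<open>m \<dots> j + 1\<close> for the ascents \<open>j\<close>.\<close>

lemma greene_le_stable_greene:
  assumes k: "card ascents \<le> k"
  shows "greene r (word_power u k) \<le> stable_greene r k"
proof -
  let ?D = "card ascents"
  let ?lw = "map (\<lambda>(t, i). (t + rank i, i)) (occurrences k)"
  let ?c = "\<lambda>l. length (filter (\<lambda>x. fst x = l) ?lw)"
  \<comment> \<open>Equal labels force a smaller rank, hence a smaller letter, in a later copy;
    within one copy the ranks agree and the letters descend.\<close>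
  have "sorted_wrt (\<lambda>x y. fst x = fst y \<longrightarrow> snd y < snd x) ?lw"
    unfolding sorted_wrt_map
  proof (rule sorted_wrt_occurrences; clarsimp)
    fix t t' i i' :: nat
    assume "t < t'" "t + rank i = t' + rank i'"
    then have "rank i' < rank i" by linarith
    then show "i' < i" using rank_mono[of i i'] by (meson not_le)
  next
    fix i i' :: nat
    assume "Suc 0 \<le> i" "i' \<le> m" "p i < p i'" "rank i = rank i'"
    then show "i' < i" using rank_eq_imp_descending[of i i'] by (cases "i \<le> i'") auto
  qed
  moreover have "fst ` set ?lw \<subseteq> {..<k + ?D}"
    using rank_le by (force simp: set_occurrences intro: add_less_le_mono)
  moreover have "map snd ?lw = word_power u k"
    by (simp add: comp_def case_prod_beta flip: map_snd_occurrences)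
  ultimately have "greene r (word_power u k) \<le> (\<Sum>l<k + ?D. min r (?c l))"
    using greene_le_cover[of ?lw "{..<k + ?D}" r] by simp
  \<comment> \<open>Labels below \<open>?D\<close> and from \<open>k\<close> on are matched with the
    ascents by \<open>rank\<close>; those between contribute at most \<open>r\<close> each.\<close>
  also have "{..<k + ?D} = {..<?D} \<union> ({?D..<k} \<union> {k..<k + ?D})"
    using k by auto
  also have "(\<Sum>l\<in>\<dots>. min r (?c l))
      = (\<Sum>l<?D. min r (?c l)) + ((\<Sum>l=?D..<k. min r (?c l)) + (\<Sum>l=k..<k + ?D. min r (?c l)))"
    using k by (subst sum.union_disjoint; (subst sum.union_disjoint)?) auto
  also have "(\<Sum>l=k..<k + ?D. min r (?c l)) = (\<Sum>l<?D. min r (?c (k + l)))"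
    using sum.shift_bounds_nat_ivl[of "\<lambda>l. min r (?c l)" 0 k ?D]
    by (simp add: lessThan_atLeast0 add.commute)
  also have "\<dots> = (\<Sum>j\<in>ascents. min r (?c (k + rank j)))"
    using sum.reindex_bij_betw[OF bij_betw_rank, of "\<lambda>l. min r (?c (k + l))"] by simp
  also have "(\<Sum>l<?D. min r (?c l)) = (\<Sum>j\<in>ascents. min r (?c (rank j)))"
    using sum.reindex_bij_betw[OF bij_betw_rank, of "\<lambda>l. min r (?c l)"] by simp
  finally have bound: "greene r (word_power u k) \<le> (\<Sum>j\<in>ascents. min r (?c (rank j)))
      + ((\<Sum>l=?D..<k. min r (?c l)) + (\<Sum>j\<in>ascents. min r (?c (k + rank j))))" .
  have c: "?c l \<le> card {i \<in> {1..m}. rank i \<le> l \<and> l < k + rank i}" for l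
  proof -
    have "?c l = card {x \<in> {..<k} \<times> {1..m}. fst x + rank (snd x) = l}"
      by (simp add: filter_map comp_def case_prod_beta length_filter_occurrences)
    also have "\<dots> \<le> card {i \<in> {1..m}. rank i \<le> l \<and> l < k + rank i}"
      by (rule card_inj_on_le[of snd]) (auto simp: inj_on_def)
    finally show ?thesis .
  qed
  \<comment> \<open>Label \<open>rank j\<close> holds only letters up to \<open>j\<close>, and label
    \<open>k + rank j\<close> only letters above \<open>j\<close>.\<close>
  have low: "?c (rank j) \<le> j" if "j \<in> ascents" for j
  proof -
    have "card {i \<in> {1..m}. rank i \<le> rank j \<and> rank j < k + rank i} \<le> card {1..j}"
      using rank_less[OF that] by (intro card_mono) (force simp: not_le[symmetric])+
    then show ?thesis using c[of "rank j"] by simp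
  qed
  have high: "?c (k + rank j) \<le> m - j" for j
  proof -
    have "card {i \<in> {1..m}. rank i \<le> k + rank j \<and> k + rank j < k + rank i} \<le> card {j<..m}"
      using rank_mono[of _ j] by (intro card_mono) (force simp: not_le[symmetric])+
    then show ?thesis using c[of "k + rank j"] by simp
  qed
  have "(\<Sum>l=?D..<k. min r (?c l)) \<le> (\<Sum>l=?D..<k. r)"
    by (intro sum_mono) simp
  moreover have "(\<Sum>j\<in>ascents. min r (?c (rank j))) \<le> (\<Sum>j\<in>ascents. min r j)"
    by (intro sum_mono min.mono low) simp_all
  moreover have "(\<Sum>j\<in>ascents. min r (?c (k + rank j))) \<le> (\<Sum>j\<in>ascents. min r (m - j))"
    by (intro sum_mono min.mono high) simp_all
  ultimately show ?thesis
    using bound by (simp add: stable_greene_def sum.distrib mult.commute)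
qed

text \<open>The letters of the \<open>s\<close>-th chain, \<open>1 \<le> s \<le> r\<close>, climb from \<open>s\<close> to \<open>m - r + s\<close>, by one
  letter per copy of \<open>u\<close> and starting in copy \<open>r - s\<close>; the delay keeps the chains disjoint.
  In the copy where it climbs from \<open>j\<close> to \<open>j + 1\<close> the chain uses both letters if \<open>j\<close> is an ascent.\<close>

definition height :: "nat \<Rightarrow> nat \<Rightarrow> nat \<Rightarrow> nat" where
  "height r s t = s + min (m - r) (t - (r - s))"

definition chain_letters :: "nat \<Rightarrow> nat \<Rightarrow> nat \<Rightarrow> nat set" where
  "chain_letters r s t =
     {i. i = height r s t \<or> i = height r s (Suc t) \<and> p (height r s t) < p i}"

lemma height_mono: "t \<le> t' \<Longrightarrow> height r s t \<le> height r s t'"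
  unfolding height_def by (intro add_left_mono min.mono) auto

lemma chain_letters_bounds:
  assumes "i \<in> chain_letters r s t"
  shows "height r s t \<le> i" "i \<le> height r s (Suc t)"
  using assms height_mono[of t "Suc t" r s] by (auto simp: chain_letters_def)

lemma chain_letters_range:
  assumes "i \<in> chain_letters r s t" "s \<in> {1..r}" "r \<le> m"
  shows "i \<in> {1..m}"
  using chain_letters_bounds[OF assms(1)] assms(2,3) by (auto simp: height_def min_def split: if_splits)

text \<open>A chain with smaller \<open>s\<close> starts at least one copy later, so even its next
  height stays below the current height of the other.\<close>

lemma chain_letters_disjoint:
  assumes "i \<in> chain_letters r s t" "i \<in> chain_letters r s' t" "s \<in> {1..r}" "s' \<in> {1..r}"
  shows "s = s'"
proof -
  have less: "height r a (Suc t) < height r b t" if "a < b" "b \<le> r" for a b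
  proof -
    have "Suc t - (r - a) \<le> t - (r - b)"
      using that by linarith
    then show ?thesis
      unfolding height_def using that(1) by (intro add_less_le_mono min.mono order_refl)
  qed
  show ?thesis
    using less[of s s'] less[of s' s] chain_letters_bounds[OF assms(1)] chain_letters_bounds[OF assms(2)] assms(3,4)
    by (cases s s' rule: linorder_cases) auto
qed

lemma chain_letters_increasing:
  assumes "i \<in> chain_letters r s t" "i' \<in> chain_letters r s t'" "t < t' \<or> t = t' \<and> p i < p i'"
  shows "i \<le> i'"
proof (cases "t < t'")
  case True
  then have "height r s (Suc t) \<le> height r s t'" by (intro height_mono) simp
  with assms(1,2) show ?thesis by (meson chain_letters_bounds le_trans)
next
  case False
  then show ?thesis using assms height_mono[of t "Suc t" r s] by (auto simp: chain_letters_def)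
qed

lemma finite_chain_letters [simp]: "finite (chain_letters r s t)"
  by (rule finite_subset[of _ "{height r s t, height r s (Suc t)}"]) (auto simp: chain_letters_def)

lemma card_chain_letters:
  "card (chain_letters r s t) \<ge> 1 + of_bool (r - s \<le> t \<and> t - (r - s) < m - r \<and> height r s t \<in> ascents)"
proof (cases "r - s \<le> t \<and> t - (r - s) < m - r \<and> height r s t \<in> ascents")
  case True
  then have "height r s (Suc t) = Suc (height r s t)"
    by (simp add: height_def Suc_diff_le)
  then have "chain_letters r s t = {height r s t, Suc (height r s t)}"
    using True by (auto simp: chain_letters_def ascents_def)
  then show ?thesis by simp
next
  case False
  have "{height r s t} \<subseteq> chain_letters r s t"
    by (auto simp: chain_letters_def)
  then have "card {height r s t} \<le> card (chain_letters r s t)"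
    by (intro card_mono) simp_all
  with False show ?thesis by auto
qed

text \<open>Each chain takes a letter from every copy and a second one at each ascent it crosses;
  chain \<open>s\<close> crosses those from \<open>s\<close> to \<open>s + (m - r) - 1\<close>.
  Double counting pairs of a chain and an ascent gives the formula.\<close>

lemma stable_greene_le_greene:
  assumes r: "r \<le> m" and k: "m \<le> Suc k"
  shows "stable_greene r k \<le> greene r (word_power u k)"
proof -
  \<comment> \<open>Chains are numbered from 1 but colours from 0; \<open>r\<close> marks uncovered
    letters.\<close>
  define col where "col x = (if \<exists>s\<in>{1..r}. snd x \<in> chain_letters r s (fst x)
      then (THE s. s \<in> {1..r} \<and> snd x \<in> chain_letters r s (fst x)) - 1 else r)" for x
  have col: "col (t, i) = s - 1" if "s \<in> {1..r}" "i \<in> chain_letters r s t" for s t i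
  proof -
    have "(THE s. s \<in> {1..r} \<and> i \<in> chain_letters r s t) = s"
      using that chain_letters_disjoint by (intro the_equality) blast+
    then show ?thesis using that by (auto simp: col_def)
  qed
  have colE: "\<exists>s\<in>{1..r}. i \<in> chain_letters r s t \<and> col (t, i) = s - 1" if "col (t, i) < r" for t i
  proof -
    have "\<exists>s\<in>{1..r}. i \<in> chain_letters r s t"
      using that by (simp add: col_def split: if_splits)
    then show ?thesis using col by blast
  qed
  let ?cs = "map (\<lambda>x. (snd x, col x)) (occurrences k)"
  have incr: "i \<le> i'"
    if *: "col (t, i) = col (t', i')" "col (t, i) < r" "t < t' \<or> t = t' \<and> p i < p i'" for t t' i i'
  proof -
    obtain s where s: "s \<in> {1..r}" "i \<in> chain_letters r s t" "col (t, i) = s - 1"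
      using colE[OF *(2)] by blast
    obtain s' where s': "s' \<in> {1..r}" "i' \<in> chain_letters r s' t'" "col (t', i') = s' - 1"
      using colE[of t' i'] * by auto
    have "s = s'" using s s' *(1) by auto
    then show ?thesis using chain_letters_increasing[OF s(2), of i' t'] s' *(3) by blast
  qed
  have "chains r ?cs"
    unfolding chains_def sorted_wrt_map by (rule sorted_wrt_occurrences) (use incr in auto)
  from used_le_greene[OF this] have "used r ?cs \<le> greene r (word_power u k)"
    by (simp add: comp_def map_snd_occurrences)
  moreover have "card (SIGMA s:{1..r}. SIGMA t:{..<k}. chain_letters r s t) \<le> used r ?cs"
  proof -
    have "used r ?cs = card {x \<in> {..<k} \<times> {1..m}. col x < r}"
      by (simp add: used_def filter_map comp_def length_filter_occurrences)
    moreover have "card (SIGMA s:{1..r}. SIGMA t:{..<k}. chain_letters r s t) \<le> \<dots>"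
    proof (rule card_inj_on_le[of snd])
      show "inj_on snd (SIGMA s:{1..r}. SIGMA t:{..<k}. chain_letters r s t)"
        using chain_letters_disjoint by (force simp: inj_on_def)
      have "i \<in> {1..m} \<and> col (t, i) < r" if "s \<in> {1..r}" "i \<in> chain_letters r s t" for s t i
        using chain_letters_range[OF that(2,1) r] col[OF that] that(1) by auto
      then show "snd ` (SIGMA s:{1..r}. SIGMA t:{..<k}. chain_letters r s t)
          \<subseteq> {x \<in> {..<k} \<times> {1..m}. col x < r}"
        by fastforce
    qed simp
    ultimately show ?thesis by simp
  qed
  moreover have "card (SIGMA s:{1..r}. SIGMA t:{..<k}. chain_letters r s t)
      = (\<Sum>s=1..r. \<Sum>t<k. card (chain_letters r s t))"
    by simp
  moreover have "(\<Sum>t<k. card (chain_letters r s t)) \<ge> k + card (ascents \<inter> {s..<s + (m - r)})"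
    if s: "s \<in> {1..r}" for s
  proof -
    let ?P = "\<lambda>t. r - s \<le> t \<and> t - (r - s) < m - r \<and> height r s t \<in> ascents"
    have card_of_bool: "card {t. t < k \<and> P t} = (\<Sum>t<k. of_bool (P t))" for P :: "nat \<Rightarrow> bool"
      by (simp add: of_bool_def sum.If_cases Int_def)
    have "card (ascents \<inter> {s..<s + (m - r)}) \<le> card {t. t < k \<and> ?P t}"
    proof (rule card_inj_on_le)
      show "inj_on (\<lambda>a. a - s + (r - s)) (ascents \<inter> {s..<s + (m - r)})"
        by (auto simp: inj_on_def)
      show "(\<lambda>a. a - s + (r - s)) ` (ascents \<inter> {s..<s + (m - r)}) \<subseteq> {t. t < k \<and> ?P t}"
      proof (rule image_subsetI)
        fix a assume a: "a \<in> ascents \<inter> {s..<s + (m - r)}"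
        then have "a - s < m - r" "s + (a - s) = a" by auto
        \<comment> \<open>Chain \<open>s\<close> climbs from \<open>a\<close> in this copy, whose
          number is at most \<open>m - s - 1\<close>; as \<open>s\<close> is at least 1,
          \<open>m - 1\<close> copies suffice.\<close>
        moreover from this have "a - s + (r - s) < k"
          using s k r unfolding atLeastAtMost_iff by linarith
        ultimately show "a - s + (r - s) \<in> {t. t < k \<and> ?P t}"
          using a by (simp add: height_def)
      qed
    qed simp
    also have "\<dots> = (\<Sum>t<k. of_bool (?P t))"
      by (rule card_of_bool)
    finally have "k + card (ascents \<inter> {s..<s + (m - r)}) \<le> (\<Sum>t<k. 1 + of_bool (?P t))"
      by (simp only: sum.distrib) simp
    also have "\<dots> \<le> (\<Sum>t<k. card (chain_letters r s t))"
      by (intro sum_mono card_chain_letters)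
    finally show ?thesis .
  qed
  then have "(\<Sum>s=1..r. k + card (ascents \<inter> {s..<s + (m - r)}))
      \<le> (\<Sum>s=1..r. \<Sum>t<k. card (chain_letters r s t))"
    by (intro sum_mono) blast
  ultimately have "r * k + (\<Sum>s=1..r. card (ascents \<inter> {s..<s + (m - r)})) \<le> greene r (word_power u k)"
    by (simp add: sum.distrib)
  moreover have "(\<Sum>s=1..r. card (ascents \<inter> {s..<s + (m - r)}))
      = (\<Sum>j\<in>ascents. min r j - (j - (m - r)))"
  proof -
    have "(\<Sum>s=1..r. card (ascents \<inter> {s..<s + (m - r)}))
        = (\<Sum>s=1..r. \<Sum>j\<in>ascents. of_bool (s \<le> j \<and> j < s + (m - r)))"
      by (intro sum.cong) (simp_all add: of_bool_def sum.If_cases Int_def)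
    also have "\<dots> = (\<Sum>j\<in>ascents. \<Sum>s=1..r. of_bool (s \<le> j \<and> j < s + (m - r)))"
      by (rule sum.swap)
    also have "\<dots> = (\<Sum>j\<in>ascents. min r j - (j - (m - r)))"
    proof (rule sum.cong)
      fix j
      have "{s \<in> {1..r}. s \<le> j \<and> j < s + (m - r)} = {Suc (j - (m - r))..min r j}"
        by auto
      then show "(\<Sum>s=1..r. of_bool (s \<le> j \<and> j < s + (m - r))) = min r j - (j - (m - r))"
        by (simp add: of_bool_def sum.If_cases Int_def)
    qed simp
    finally show ?thesis .
  qed
  moreover have "(\<Sum>j\<in>ascents. min r j - (j - (m - r))) + r * card ascents
      = (\<Sum>j\<in>ascents. min r j + min r (m - j))"
  proof -
    have "(\<Sum>j\<in>ascents. min r j - (j - (m - r))) + r * card ascents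
        = (\<Sum>j\<in>ascents. (min r j - (j - (m - r))) + r)"
      by (simp add: sum.distrib)
    \<comment> \<open>Termwise, \<open>r - (j - (m - r))\<close> equals
      \<open>min r (m - j)\<close>.\<close>
    also have "\<dots> = (\<Sum>j\<in>ascents. min r j + min r (m - j))"
      by (intro sum.cong) (use r in \<open>auto simp: min_def dest!: ascentsD\<close>)
    finally show ?thesis .
  qed
  moreover have "r * (k - card ascents) + r * card ascents = r * k"
    using card_ascents_le[OF k] by (simp flip: distrib_left)
  ultimately show ?thesis
    unfolding stable_greene_def by linarith
qed

lemma greene_word_power_Suc:
  assumes r: "r \<le> m" and k: "m \<le> Suc k"
  shows "greene r (word_power u (Suc k)) = r + greene r (word_power u k)"
proof -
  have eq: "greene r (word_power u k') = stable_greene r k'" if "m \<le> Suc k'" for k'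
    using greene_le_stable_greene[OF card_ascents_le[OF that]] stable_greene_le_greene[OF r that]
    by (rule antisym)
  show ?thesis
    using eq[OF k] eq[of "Suc k"] k card_ascents_le[OF k]
    by (simp add: stable_greene_def Suc_diff_le)
qed

end

section \<open>From Greene numbers of powers to stability\<close>

lemma greene_word_power_Suc:
  assumes "u \<in> permutations_of_set {1..m}" "r \<le> m" "m \<le> Suc k"
  shows "greene r (word_power u (Suc k)) = r + greene r (word_power u k)"
proof -
  have u: "set u = {1..m}" "distinct u"
    using assms(1) by (auto simp: permutations_of_set_def)
  define p where "p = the_inv_into {..<length u} ((!) u)"
  have "p (u ! a) = a" if "a < length u" for a
    unfolding p_def using u(2) that by (intro the_inv_into_f_f) (auto simp: inj_on_nth)
  then have "sorted_wrt (\<lambda>i j. p i < p j) u"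
    by (simp add: sorted_wrt_iff_nth_less)
  then interpret permutation_word m u p
    by unfold_locales (rule u(1))
  show ?thesis using assms(2,3) by (rule greene_word_power_Suc)
qed

lemma greene_eq_length:
  assumes "set w \<subseteq> {1..r}"
  shows "greene r w = length w"
proof (rule antisym[OF greene_le_length])
  have "filter (\<lambda>l. l \<le> r) w = w"
    using assms by (auto simp: filter_id_conv)
  then show "length w \<le> greene r w"
    using filter_le_greene[of w r] assms by force
qed

text \<open>Restricting \<open>u\<close> to letters up to \<open>i\<close> gives a permutation of
  the first \<open>min i m\<close> numbers, for which the bound on \<open>k\<close> still holds, so
  the growth of Greene numbers applies to every restriction.\<close>

lemma plactic_word_power_Suc:
  assumes u: "u \<in> permutations_of_set {1..m}" and k: "m \<le> Suc k"
  shows "word_power u (Suc k) \<approx> column m @ word_power u k"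
proof (rule placticI)
  fix i r
  define n and v where "n = min i m" and "v = filter (\<lambda>l. l \<le> i) u"
  have v: "v \<in> permutations_of_set {1..n}"
    using u by (auto simp: permutations_of_set_def v_def n_def)
  then have set_v: "set (word_power v k') \<subseteq> {1..n}" for k'
    using set_word_power[of v k'] by (auto simp: permutations_of_set_def)
  have len: "length v = n"
    using v by (auto simp: permutations_of_set_def dest: distinct_card)
  have "greene r (word_power v (Suc k)) = min r n + greene r (word_power v k)"
  proof (cases "r \<le> n")
    case True
    then show ?thesis using greene_word_power_Suc[OF v True] k by (simp add: n_def)
  next
    case False
    \<comment> \<open>For \<open>r > n\<close> every letter is covered, so Greene numbers are
      lengths.\<close>
    then have "set (word_power v k') \<subseteq> {1..r}" for k'
      using set_v[of k'] by auto
    then show ?thesis using False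
      by (simp add: greene_eq_length length_word_power len)
  qed
  also have "\<dots> = greene r (column n @ word_power v k)"
    using set_v[of k] by (subst greene_column_prefix) auto
  finally show "greene r (filter (\<lambda>l. l \<le> i) (word_power u (Suc k)))
      = greene r (filter (\<lambda>l. l \<le> i) (column m @ word_power u k))"
    by (simp add: filter_word_power filter_column v_def n_def)
qed

theorem theorem3p7:
  fixes m :: nat and u :: "nat list"
  assumes "m \<ge> 1"
    and "u \<in> permutations_of_set {1..m}"
  shows "K_stable m u"
proof -
  have set_u: "set (word_power u k) \<subseteq> {1..m}" for k
    using assms(2) set_word_power[of u k] by (auto simp: permutations_of_set_def)
  have "centralizer (word_power u (Suc k)) = centralizer (word_power u k)" if k: "m \<le> k" for k
  proof -
    have step: "word_power u (Suc k') \<approx> column m @ word_power u k'" if "m \<le> Suc k'" for k'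
      using assms(2) that by (rule plactic_word_power_Suc)
    have "word_power u (Suc k) @ w \<approx> w @ word_power u (Suc k) \<longleftrightarrow> word_power u k @ w \<approx> w @ word_power u k"
      if "w \<in> words" for w
    proof -
      have w: "0 \<notin> set w" using that by (auto simp: words_def lists_eq_set)
      let ?a = "filter (\<lambda>l. l \<le> m) w"
      have a: "set ?a \<subseteq> {1..m}" using w by (auto simp: Suc_le_eq intro: gr0I)
      \<comment> \<open>A column must split off from the \<open>k\<close>-th power as well as from
        the next one, so that \<open>commute_iff\<close> applies to both; this uses
        \<open>m \<le> k\<close> rather than \<open>m \<le> Suc k\<close>.\<close>
      obtain k' where k': "k = Suc k'" using k assms(1) by (cases k) auto
      show ?thesis
        using commute_iff[OF w set_u step[of k]] commute_iff[OF w set_u step[of k'], folded k'] k k'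
          commute_column_iff[OF set_u a step[of k]] by simp
    qed
    then show ?thesis
      unfolding centralizer_def insertion_tableau_eq_iff by blast
  qed
  note step = this
  have "centralizer (word_power u k) = centralizer (word_power u m)" if "m \<le> k" for k
    using that by (induction k rule: dec_induct) (simp_all add: step)
  then show ?thesis unfolding K_stable_def by blast
qed

end
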